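(* Let $T=2^c-1$ for some integer $c\ge2$. Given some admissible relaxation $\mathbf{Rel}$, the regret of the Adaptive Localized Meta-Algorithm is bounded as $$\mathbf{Reg}_T\le\sum_{i=1}^{N}\mathbf{Rel}_{k_i^*}\Big(\mathcal F_{r(k_i^*;x_1,\dots,x_{\tilde k^*_{i-1}})}\Big),$$ where $N$ is the number of blocks actually played, $k_1^*,\dots,k_N^*$ are the adaptive block lengths defined within the algorithm, and $\tilde k^*_{i}=\sum_{j\le i}k^*_j$. Further, irrespective of the blocking strategy $\mathbf{Block}$ used, if the relaxation $\mathbf{Rel}$ is such that for any $t$, $\mathbf{Rel}_t(\mathcal F)\le t^p$ for some $p\in(0,1]$, then the worst-case regret is always bounded as $$\mathbf{Reg}_T\le\frac{T^p-2^{-p}}{1-2^{-p}}.$$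
   Context: Online game: $\mathcal F$ (learner's moves) and $\mathcal X$ (Nature's moves) are sets, $\ell:\mathcal F\times\mathcal X\to\mathbb R$ is a loss, $\Delta(A)$ is the set of distributions on $A$. On each round $t=1,\dots,T$ the learner picks $q_t\in\Delta(\mathcal F)$ and plays $f_t\sim q_t$, and Nature simultaneously picks $x_t\in\mathcal X$. Regret: $\mathbf{Reg}_T=\sum_{t=1}^T\ell(f_t,x_t)-\inf_{f\in\mathcal F}\sum_{t=1}^T\ell(f,x_t)$. It is assumed throughout that $\ell,\mathcal F,\mathcal X$ are such that the minimax theorem in the space of distributions over $\mathcal F$ and $\mathcal X$ holds. Admissible relaxation: for a horizon $k$ and a class $\mathcal G\subseteq\mathcal F$, functions $\mathbf{Rel}_k(\mathcal G\mid z_1,\dots,z_j)$, $0\le j\le k$, $z_i\in\mathcal X$, with $\mathbf{Rel}_k(\mathcal G)$ the value at the empty sequence, such that $\mathbf{Rel}_k(\mathcal G\mid z_1,\dots,z_j)\ge\inf_{q\in\Delta(\mathcal G)}\sup_{x\in\mathcal X}\{\mathbb E_{f\sim q}\ell(f,x)+\mathbf{Rel}_k(\mathcal G\mid z_1,\dots,z_j,x)\}$ for $0\le j\le k-1$, and $\mathbf{Rel}_k(\mathcal G\mid z_1,\dots,z_k)\ge-\inf_{f\in\mathcal G}\sum_{j=1}^k\ell(f,z_j)$. $\mathbf{MetAlgo}(\mathcal G)$ over $k$ rounds computes, at its $(j+1)$-st round with history $z_1,\dots,z_j$, a $q$ minimizing $\sup_{x\in\mathcal X}\{\mathbb E_{f\sim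 q}\ell(f,x)+\mathbf{Rel}_k(\mathcal G\mid z_1,\dots,z_j,x)\}$ over $\Delta(\mathcal G)$, and plays $f\sim q$. Localization: $\mathcal F^k(x_1,\dots,x_t)$ is the set of $f\in\mathcal F$ for which there exist $x_{t+1},\dots,x_{t+k}\in\mathcal X$ with $\sum_{i=1}^{t+k}\ell(f,x_i)=\inf_{g\in\mathcal F}\sum_{i=1}^{t+k}\ell(g,x_i)$. For a fixed real-valued "property" $P(f\mid x_1,\dots,x_t)$ of $f$ given data: $\mathcal F_r(x_1,\dots,x_t)=\{f\in\mathcal F:P(f\mid x_1,\dots,x_t)\le r\}$, $r(k;x_1,\dots,x_t)=\inf\{r:\mathcal F^k(x_1,\dots,x_t)\subset\mathcal F_r(x_1,\dots,x_t)\}$, and $\mathcal F_{r(k;x_1,\dots,x_t)}$ abbreviates $\mathcal F_{r(k;x_1,\dots,x_t)}(x_1,\dots,x_t)$. Blocking strategy: $\mathbf{Block}(\{x_1,\dots,x_s\},\tau)$ returns, given the history, a subdivision of the next $\tau$ rounds into sub-blocks, i.e. a tuple of positive integers summing to $\tau$. Adaptive Localized Meta-Algorithm: the rounds are split into super-blocks $i=0,\dots,c-1$, super-block $i$ consisting of the $2^i$ rounds $2^i,\dots,2^{i+1}-1$. Within super-block $i$, after $s$ rounds in total have been played, the algorithm holds a plan $K=(K_1,\dots,K_m)$ of positive integers summing to the number of remaining rounds of the super-block, whose guaranteed value is $$G(K;x_1,\dots,x_s)=\sup_{x_{s+1},\dots,x_{2^{i+1}-1}}\sum_{j=1}^m\mathbf{Rel}_{K_j}\big(\mathcal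 F_{r(K_j;x_1,\dots,x_{s+K_1+\dots+K_{j-1}})}\big).$$ At the start of the super-block $K=(2^i)$. While rounds remain in the super-block: compute $\kappa=\mathbf{Block}(\{x_1,\dots,x_s\},\text{number of remaining rounds of the super-block})$; if $G(K;x_1,\dots,x_s)>G(\kappa;x_1,\dots,x_s)$, replace $K$ by $\kappa$, otherwise keep $K$; then play one block of $K_1$ rounds using $\mathbf{MetAlgo}(\mathcal F_{r(K_1;x_1,\dots,x_s)})$ with horizon $K_1$ (its history being the data of the current block), and replace $K$ by $(K_2,\dots,K_m)$. The $k_i^*$ are the lengths of the blocks played, in order.
   Formalization: Regret is in expectation over the draws, for every sequence x; added assumptions, without which the claim fails: the infimum over F of the cumulative loss is attained after each t ≤ T rounds, and, for the second bound, Rel_t(G) ≤ Rel_t(F) for all nonempty G ⊆ F. *)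

theory Defs
  imports "HOL-Probability.Probability"
begin

(* Histories x_1, ..., x_t are lists, x_{t+1} being the list entry with index t. Infima and suprema
   are taken in ereal, so that the conventions for empty and unbounded sets are the usual ones. *)

definition cum_loss :: "('f \<Rightarrow> 'x \<Rightarrow> real) \<Rightarrow> 'f \<Rightarrow> 'x list \<Rightarrow> real" where
  "cum_loss loss f xs = (\<Sum>x\<leftarrow>xs. loss f x)"

(* Distributions on A, with respect to the trace on A of the sigma-algebra of M (A itself need not
   be measurable). Integrability of the losses is required because otherwise the expected loss
   would be undefined; for bounded losses it is automatic. *)
definition dists :: "'f measure \<Rightarrow> 'x set \<Rightarrow> ('f \<Rightarrow> 'x \<Rightarrow> real) \<Rightarrow> 'f set \<Rightarrow> 'f measure set" where
  "dists M X loss A = {q. prob_space q \<and> space q = A \<and> sets q = sets (restrict_space M A) \<and>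
     (\<forall>x\<in>X. integrable q (\<lambda>f. loss f x))}"

(* The infimum is a real one: it is used only where it is attained. *)
definition regret :: "'f set \<Rightarrow> ('f \<Rightarrow> 'x \<Rightarrow> real) \<Rightarrow> (nat \<Rightarrow> 'f) \<Rightarrow> 'x list \<Rightarrow> real" where
  "regret F loss f xs =
     (\<Sum>t<length xs. loss (f t) (xs ! t)) - (INF g\<in>F. cum_loss loss g xs)"

(* The learner draws f t from q (x_1, ..., x_t), the distribution chosen after t rounds. *)
definition expected_regret ::
  "'f set \<Rightarrow> ('f \<Rightarrow> 'x \<Rightarrow> real) \<Rightarrow> ('x list \<Rightarrow> 'f measure) \<Rightarrow> 'x list \<Rightarrow> real" where
  "expected_regret F loss q xs =
     (LINT f|PiM {..<length xs} (\<lambda>t. q (take t xs)). regret F loss f xs)"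


(* sup_x { E_{f ~ q} loss f x + Rel_k(G | z_1, ..., z_j, x) } *)
definition step_value ::
  "'x set \<Rightarrow> ('f \<Rightarrow> 'x \<Rightarrow> real) \<Rightarrow> (nat \<Rightarrow> 'f set \<Rightarrow> 'x list \<Rightarrow> real) \<Rightarrow>
   nat \<Rightarrow> 'f set \<Rightarrow> 'x list \<Rightarrow> 'f measure \<Rightarrow> ereal" where
  "step_value X loss Rel k G zs q =
     (SUP x\<in>X. ereal ((LINT f|q. loss f x) + Rel k G (zs @ [x])))"

(* The empty class is excluded: there are no distributions on it. *)
definition admissible ::
  "'f measure \<Rightarrow> 'x set \<Rightarrow> ('f \<Rightarrow> 'x \<Rightarrow> real) \<Rightarrow> (nat \<Rightarrow> 'f set \<Rightarrow> 'x list \<Rightarrow> real) \<Rightarrow> bool" where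
  "admissible M X loss Rel \<longleftrightarrow>
     (\<forall>k\<ge>1. \<forall>G. G \<subseteq> space M \<longrightarrow> G \<noteq> {} \<longrightarrow>
        (\<forall>zs. set zs \<subseteq> X \<longrightarrow> length zs < k \<longrightarrow>
           ereal (Rel k G zs) \<ge> (INF q\<in>dists M X loss G. step_value X loss Rel k G zs q)) \<and>
        (\<forall>zs. set zs \<subseteq> X \<longrightarrow> length zs = k \<longrightarrow>
           ereal (Rel k G zs) \<ge> - (INF f\<in>G. ereal (cum_loss loss f zs))))"

definition met_algo_choice ::
  "'f measure \<Rightarrow> 'x set \<Rightarrow> ('f \<Rightarrow> 'x \<Rightarrow> real) \<Rightarrow> (nat \<Rightarrow> 'f set \<Rightarrow> 'x list \<Rightarrow> real) \<Rightarrow>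
   nat \<Rightarrow> 'f set \<Rightarrow> 'x list \<Rightarrow> 'f measure \<Rightarrow> bool" where
  "met_algo_choice M X loss Rel k G zs q \<longleftrightarrow>
     is_arg_min (step_value X loss Rel k G zs) (\<lambda>q. q \<in> dists M X loss G) q"


definition possible_minimizers ::
  "'f set \<Rightarrow> 'x set \<Rightarrow> ('f \<Rightarrow> 'x \<Rightarrow> real) \<Rightarrow> nat \<Rightarrow> 'x list \<Rightarrow> 'f set" where
  "possible_minimizers F X loss k xs =
     {f \<in> F. \<exists>zs. set zs \<subseteq> X \<and> length zs = k \<and>
        ereal (cum_loss loss f (xs @ zs)) = (INF g\<in>F. ereal (cum_loss loss g (xs @ zs)))}"

definition sublevel_class :: "'f set \<Rightarrow> ('f \<Rightarrow> 'x list \<Rightarrow> real) \<Rightarrow> ereal \<Rightarrow> 'x list \<Rightarrow> 'f set" where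
  "sublevel_class F P r xs = {f \<in> F. ereal (P f xs) \<le> r}"

(* The radius is infinite if P is unbounded above on the possible minimizers; the localized class
   is then the whole of F. *)
definition loc_radius ::
  "'f set \<Rightarrow> 'x set \<Rightarrow> ('f \<Rightarrow> 'x \<Rightarrow> real) \<Rightarrow> ('f \<Rightarrow> 'x list \<Rightarrow> real) \<Rightarrow> nat \<Rightarrow> 'x list \<Rightarrow> ereal" where
  "loc_radius F X loss P k xs =
     Inf {ereal r |r. possible_minimizers F X loss k xs \<subseteq> sublevel_class F P (ereal r) xs}"

definition loc_class ::
  "'f set \<Rightarrow> 'x set \<Rightarrow> ('f \<Rightarrow> 'x \<Rightarrow> real) \<Rightarrow> ('f \<Rightarrow> 'x list \<Rightarrow> real) \<Rightarrow> nat \<Rightarrow> 'x list \<Rightarrow> 'f set" where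
  "loc_class F X loss P k xs = sublevel_class F P (loc_radius F X loss P k xs) xs"

(* Rel_k(F_{r(k; x_1, ..., x_s)}). The algorithm chooses its block lengths on the basis of this
   function only; it is the parameter V below. *)
definition loc_rel ::
  "'f set \<Rightarrow> 'x set \<Rightarrow> ('f \<Rightarrow> 'x \<Rightarrow> real) \<Rightarrow> ('f \<Rightarrow> 'x list \<Rightarrow> real) \<Rightarrow>
   (nat \<Rightarrow> 'f set \<Rightarrow> 'x list \<Rightarrow> real) \<Rightarrow> nat \<Rightarrow> 'x list \<Rightarrow> real" where
  "loc_rel F X loss P Rel k xs = Rel k (loc_class F X loss P k xs) []"


definition blocking_strategy :: "'x set \<Rightarrow> ('x list \<Rightarrow> nat \<Rightarrow> nat list) \<Rightarrow> bool" where
  "blocking_strategy X Block \<longleftrightarrow>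
     (\<forall>xs n. set xs \<subseteq> X \<longrightarrow> n > 0 \<longrightarrow>
        sum_list (Block xs n) = n \<and> (\<forall>k\<in>set (Block xs n). k > 0))"

definition guarantee ::
  "'x set \<Rightarrow> (nat \<Rightarrow> 'x list \<Rightarrow> real) \<Rightarrow> nat list \<Rightarrow> 'x list \<Rightarrow> ereal" where
  "guarantee X V K xs =
     (SUP zs\<in>{zs. set zs \<subseteq> X \<and> length zs = sum_list K}.
        ereal (\<Sum>j<length K. V (K ! j) (xs @ take (sum_list (take j K)) zs)))"

definition replan ::
  "'x set \<Rightarrow> (nat \<Rightarrow> 'x list \<Rightarrow> real) \<Rightarrow> ('x list \<Rightarrow> nat \<Rightarrow> nat list) \<Rightarrow>
   'x list \<Rightarrow> nat \<Rightarrow> nat list \<Rightarrow> nat list" where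
  "replan X V Block xs n K =
     (if guarantee X V K xs > guarantee X V (Block xs n) xs then Block xs n else K)"

(* Lengths of the blocks played in the rest of a super-block, when s rounds have been played in
   total, n rounds of the super-block remain, and K is the current plan. The test k = 0 only serves
   termination: plans consist of positive numbers. *)
function superblock_lengths ::
  "'x set \<Rightarrow> (nat \<Rightarrow> 'x list \<Rightarrow> real) \<Rightarrow> ('x list \<Rightarrow> nat \<Rightarrow> nat list) \<Rightarrow>
   'x list \<Rightarrow> nat \<Rightarrow> nat \<Rightarrow> nat list \<Rightarrow> nat list" where
  "superblock_lengths X V Block x s n K =
     (let K' = replan X V Block (take s x) n K; k = hd K'
      in if n = 0 \<or> k = 0 then []
         else k # superblock_lengths X V Block x (s + k) (n - k) (tl K'))"
  by auto
termination
  by (relation "Wellfounded.measure (\<lambda>(X, V, Block, x, s, n, K). n)") (auto simp: Let_def)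

(* Left as a simplification rule, the recursion equation would be unfolded forever. *)
declare superblock_lengths.simps [simp del]

definition block_lengths ::
  "'x set \<Rightarrow> (nat \<Rightarrow> 'x list \<Rightarrow> real) \<Rightarrow> ('x list \<Rightarrow> nat \<Rightarrow> nat list) \<Rightarrow>
   nat \<Rightarrow> 'x list \<Rightarrow> nat list" where
  "block_lengths X V Block c x =
     concat (map (\<lambda>i. superblock_lengths X V Block x (2 ^ i - 1) (2 ^ i) [2 ^ i]) [0..<c])"

(* Against the moves x, the learner's strategy q agrees with the Adaptive Localized Meta-Algorithm
   with c super-blocks. Ties between minimizing distributions may be broken in any way. *)
definition alma_play ::
  "'f measure \<Rightarrow> 'x set \<Rightarrow> ('f \<Rightarrow> 'x \<Rightarrow> real) \<Rightarrow> ('f \<Rightarrow> 'x list \<Rightarrow> real) \<Rightarrow>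
   (nat \<Rightarrow> 'f set \<Rightarrow> 'x list \<Rightarrow> real) \<Rightarrow> ('x list \<Rightarrow> nat \<Rightarrow> nat list) \<Rightarrow>
   nat \<Rightarrow> 'x list \<Rightarrow> ('x list \<Rightarrow> 'f measure) \<Rightarrow> bool" where
  "alma_play M X loss P Rel Block c x q \<longleftrightarrow>
     (let ks = block_lengths X (loc_rel (space M) X loss P Rel) Block c x
      in \<forall>i<length ks. \<forall>j<ks ! i.
           let s = sum_list (take i ks)
           in met_algo_choice M X loss Rel (ks ! i)
                (loc_class (space M) X loss P (ks ! i) (take s x))
                (take j (drop s x)) (q (take (s + j) x)))"

end

theory Submission
  imports Defs
begin

text \<open>Within a block, admissibility telescopes and bounds the expected loss by the relaxation plus
  the loss, on the data of the block, of any competitor in the localized class. The competitor is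
  taken to be a minimizer of the cumulative loss at the end of the block, which the localized class
  contains by construction. Its loss on the block is at most the increase of the minimal cumulative
  loss, so the blocks telescope as well. For the second bound, the value guaranteed by the current
  plan never increases within a super-block, and initially it is the relaxation for \<open>2 ^ i\<close> rounds;
  summing over the super-blocks gives a geometric series.\<close>

section \<open>Regret within a block\<close>

lemma cum_loss_append: "cum_loss loss f (xs @ ys) = cum_loss loss f xs + cum_loss loss f ys"
  by (simp add: cum_loss_def)

text \<open>The minimizing \<open>q\<close> attains the infimum that admissibility bounds by
  \<open>Rel k G zs\<close>, and the actual move \<open>y\<close> is one of the moves in the
  supremum.\<close>

lemma met_algo_step:
  assumes "admissible M X loss Rel" "k \<ge> 1" "G \<subseteq> space M" "G \<noteq> {}"
    and "set zs \<subseteq> X" "length zs < k" "y \<in> X"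
    and "met_algo_choice M X loss Rel k G zs q"
  shows "(LINT f|q. loss f y) + Rel k G (zs @ [y]) \<le> Rel k G zs"
proof -
  have "ereal ((LINT f|q. loss f y) + Rel k G (zs @ [y])) \<le> step_value X loss Rel k G zs q"
    unfolding step_value_def by (rule SUP_upper) fact
  also have "\<dots> \<le> (INF q\<in>dists M X loss G. step_value X loss Rel k G zs q)"
    using assms(8) by (intro INF_greatest) (auto simp: met_algo_choice_def is_arg_min_def not_less)
  also have "\<dots> \<le> ereal (Rel k G zs)"
    using assms unfolding admissible_def by blast
  finally show ?thesis by simp
qed

lemma met_algo_block_loss:
  assumes adm: "admissible M X loss Rel" "k \<ge> 1" "G \<subseteq> space M"
    and zs: "set zs \<subseteq> X" "length zs = k"
    and q: "\<And>j. j < k \<Longrightarrow> met_algo_choice M X loss Rel k G (take j zs) (q j)"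
    and f: "f \<in> G"
  shows "(\<Sum>j<k. LINT h|q j. loss h (zs ! j)) \<le> Rel k G [] + cum_loss loss f zs"
proof -
  have G: "G \<noteq> {}" using f by auto
  \<comment> \<open>The relaxation serves as a potential: expected loss so far plus its current
    value never exceeds its initial value.\<close>
  have "(\<Sum>i<j. LINT h|q i. loss h (zs ! i)) + Rel k G (take j zs) \<le> Rel k G []"
    if "j \<le> k" for j
    using that
  proof (induction j)
    case (Suc j)
    have "set (take j zs) \<subseteq> X"
      using zs set_take_subset[of j zs] by blast
    moreover have "zs ! j \<in> X"
      using zs Suc.prems nth_mem[of j zs] by auto
    ultimately have "(LINT h|q j. loss h (zs ! j)) + Rel k G (take j zs @ [zs ! j])
        \<le> Rel k G (take j zs)"
      using Suc.prems zs(2) q[of j] by (intro met_algo_step[OF adm G]) auto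
    moreover have "take (Suc j) zs = take j zs @ [zs ! j]"
      using Suc.prems zs(2) by (simp add: take_Suc_conv_app_nth)
    ultimately show ?case
      using Suc by simp
  qed simp
  from this[of k] have "(\<Sum>j<k. LINT h|q j. loss h (zs ! j)) \<le> Rel k G [] - Rel k G zs"
    using zs(2) by simp
  \<comment> \<open>The terminal condition of admissibility turns the final potential into the loss
    of the competitor.\<close>
  moreover have "- (INF f\<in>G. ereal (cum_loss loss f zs)) \<le> ereal (Rel k G zs)"
    using adm G zs unfolding admissible_def by blast
  then have "- ereal (cum_loss loss f zs) \<le> ereal (Rel k G zs)"
    using INF_lower[OF f, of "\<lambda>f. ereal (cum_loss loss f zs)"]
    by (meson ereal_minus_le_minus order_trans)
  ultimately show ?thesis by simp
qed

section \<open>Localization keeps the minimizers\<close>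

lemma possible_minimizers_subset_loc_class:
  "possible_minimizers F X loss k xs \<subseteq> loc_class F X loss P k xs"
proof
  fix f assume f: "f \<in> possible_minimizers F X loss k xs"
  \<comment> \<open>\<open>P f xs\<close> is a lower bound of the set of reals whose infimum is the
    radius. If that set is empty, the radius is infinite and the bound is trivial.\<close>
  then have "ereal (P f xs) \<le> loc_radius F X loss P k xs"
    unfolding loc_radius_def by (intro Inf_greatest) (auto simp: sublevel_class_def)
  with f show "f \<in> loc_class F X loss P k xs"
    by (simp add: loc_class_def sublevel_class_def possible_minimizers_def)
qed

text \<open>The moves that Nature actually makes in the block witness the existential quantifier in
  \<open>possible_minimizers\<close>. This justifies comparing with the minimizer at the end of the
  block.\<close>

lemma minimizer_in_loc_class:
  assumes "f \<in> F" "\<forall>g\<in>F. cum_loss loss f (xs @ zs) \<le> cum_loss loss g (xs @ zs)"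
    and "set zs \<subseteq> X" "length zs = k"
  shows "f \<in> loc_class F X loss P k xs"
proof -
  have "ereal (cum_loss loss f (xs @ zs)) = (INF g\<in>F. ereal (cum_loss loss g (xs @ zs)))"
    using assms(1,2) by (intro antisym INF_greatest INF_lower) auto
  then show ?thesis
    using assms possible_minimizers_subset_loc_class[of F X loss k xs P]
    unfolding possible_minimizers_def by blast
qed

lemma loc_class_subset: "loc_class F X loss P k xs \<subseteq> F"
  by (auto simp: loc_class_def sublevel_class_def)

lemma INF_attained_real:
  fixes h :: "'a \<Rightarrow> real"
  assumes "f \<in> F" "\<forall>g\<in>F. h f \<le> h g"
  shows "(INF g\<in>F. h g) = h f"
  using assms by (intro cInf_eq_minimum) auto

lemma localized_block_loss:
  assumes adm: "admissible M X loss Rel" and M: "space M = F" and k: "k \<ge> 1"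
    and x: "set x \<subseteq> X" "s + k \<le> length x"
    and mins: "\<forall>t\<le>length x. \<exists>f\<in>F. \<forall>g\<in>F. cum_loss loss f (take t x) \<le> cum_loss loss g (take t x)"
    and q: "\<And>j. j < k \<Longrightarrow> met_algo_choice M X loss Rel k (loc_class F X loss P k (take s x))
      (take j (drop s x)) (q (s + j))"
  shows "(\<Sum>t=s..<s + k. LINT h|q t. loss h (x ! t))
    \<le> loc_rel F X loss P Rel k (take s x)
      + (INF g\<in>F. cum_loss loss g (take (s + k) x)) - (INF g\<in>F. cum_loss loss g (take s x))"
proof -
  obtain f where f: "f \<in> F"
      "\<forall>g\<in>F. cum_loss loss f (take (s + k) x) \<le> cum_loss loss g (take (s + k) x)"
    using mins x(2) by blast
  \<comment> \<open>Besides the minimizer \<open>f\<close> at the end of the block, one at its start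
    is needed: it makes the real infimum there attained, hence at most the loss of \<open>f\<close>
    on \<open>take s x\<close>.\<close>
  obtain f' where f': "f' \<in> F"
      "\<forall>g\<in>F. cum_loss loss f' (take s x) \<le> cum_loss loss g (take s x)"
    using mins x(2) by (meson add_leD1)
  define zs where "zs = take k (drop s x)"
  have zs: "set zs \<subseteq> X" "length zs = k" "take (s + k) x = take s x @ zs"
    using x set_take_subset[of k "drop s x"] set_drop_subset[of s x]
    by (auto simp: zs_def take_add)
  have "(\<Sum>t=s..<s + k. LINT h|q t. loss h (x ! t)) = (\<Sum>j<k. LINT h|q (s + j). loss h (zs ! j))"
    using x(2) sum.shift_bounds_nat_ivl[of "\<lambda>t. LINT h|q t. loss h (x ! t)" 0 s k]
    by (simp add: zs_def add.commute lessThan_atLeast0)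
  also have "\<dots> \<le> Rel k (loc_class F X loss P k (take s x)) [] + cum_loss loss f zs"
  proof (rule met_algo_block_loss[OF adm k _ zs(1,2)])
    show "f \<in> loc_class F X loss P k (take s x)"
      using f zs by (intro minimizer_in_loc_class) auto
    show "met_algo_choice M X loss Rel k (loc_class F X loss P k (take s x)) (take j zs) (q (s + j))"
      if "j < k" for j
      using q[OF that] that by (simp add: zs_def min_def)
  qed (auto simp: M loc_class_subset)
  also have "cum_loss loss f zs
      = (INF g\<in>F. cum_loss loss g (take (s + k) x)) - cum_loss loss f (take s x)"
    using INF_attained_real[OF f] zs(3) by (simp add: cum_loss_append)
  finally show ?thesis
    using f(1) f'(2) INF_attained_real[OF f'] by (simp add: loc_rel_def) (smt (verit))
qed

section \<open>Sums over consecutive blocks\<close>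

text \<open>For \<open>s = 0\<close> and \<open>V\<close> the localized relaxation this is the
  right-hand side of the first bound. The offset \<open>s\<close> permits recursion along the list
  of blocks.\<close>

definition blocks_value ::
  "(nat \<Rightarrow> 'x list \<Rightarrow> real) \<Rightarrow> 'x list \<Rightarrow> nat \<Rightarrow> nat list \<Rightarrow> real" where
  "blocks_value V x s ks = (\<Sum>i<length ks. V (ks ! i) (take (s + sum_list (take i ks)) x))"

lemma blocks_value_Nil [simp]: "blocks_value V x s [] = 0"
  by (simp add: blocks_value_def)

lemma blocks_value_Cons [simp]:
  "blocks_value V x s (k # ks) = V k (take s x) + blocks_value V x (s + k) ks"
  by (simp add: blocks_value_def sum.lessThan_Suc_shift add.assoc del: sum.lessThan_Suc)

lemma blocks_value_append:
  "blocks_value V x s (ks @ ls) = blocks_value V x s ks + blocks_value V x (s + sum_list ks) ls"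
  by (induction ks arbitrary: s) (simp_all add: add.assoc)

lemma block_index_exists:
  fixes ks :: "nat list"
  assumes "t < sum_list ks"
  shows "\<exists>i<length ks. \<exists>j<ks ! i. t = sum_list (take i ks) + j"
  using assms
proof (induction ks arbitrary: t)
  case (Cons k ks)
  show ?case
  proof (cases "t < k")
    case False
    then have "t - k < sum_list ks" using Cons.prems by auto
    then obtain i j where "i < length ks" "j < ks ! i" "t - k = sum_list (take i ks) + j"
      using Cons.IH by blast
    with False show ?thesis
      by (intro exI[of _ "Suc i"]) (auto intro!: exI[of _ j])
  qed force
qed simp

lemma loss_le_blocks_value:
  assumes adm: "admissible M X loss Rel" and M: "space M = F"
    and x: "set x \<subseteq> X" "length x = sum_list ks" and pos: "\<forall>k\<in>set ks. k > 0"
    and mins: "\<forall>t\<le>length x. \<exists>f\<in>F. \<forall>g\<in>F. cum_loss loss f (take t x) \<le> cum_loss loss g (take t x)"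
    and q: "\<And>i j. i < length ks \<Longrightarrow> j < ks ! i \<Longrightarrow> met_algo_choice M X loss Rel (ks ! i)
      (loc_class F X loss P (ks ! i) (take (sum_list (take i ks)) x))
      (take j (drop (sum_list (take i ks)) x)) (q (sum_list (take i ks) + j))"
  shows "(\<Sum>t<length x. LINT h|q t. loss h (x ! t))
    \<le> blocks_value (loc_rel F X loss P Rel) x 0 ks + (INF g\<in>F. cum_loss loss g x)"
proof -
  define L where "L t = (INF g\<in>F. cum_loss loss g (take t x))" for t
  \<comment> \<open>Nonemptiness ensures that the real infimum of the constant 0 over
    \<open>F\<close> is 0.\<close>
  have "F \<noteq> {}" using mins by blast
  then have L0: "L 0 = 0" by (simp add: L_def cum_loss_def)
  \<comment> \<open>Induction on the number \<open>m\<close> of completed blocks; the increments of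
    the minimal loss \<open>L\<close> telescope.\<close>
  have "(\<Sum>t<sum_list (take m ks). LINT h|q t. loss h (x ! t))
      \<le> blocks_value (loc_rel F X loss P Rel) x 0 (take m ks) + L (sum_list (take m ks))"
    if "m \<le> length ks" for m
    using that
  proof (induction m)
    case (Suc m)
    define s where "s = sum_list (take m ks)"
    have take: "take (Suc m) ks = take m ks @ [ks ! m]"
      using Suc.prems by (simp add: take_Suc_conv_app_nth)
    have "s + ks ! m \<le> length x"
      using x(2) take arg_cong[OF append_take_drop_id[of "Suc m" ks], of sum_list]
      by (simp add: s_def)
    then have "(\<Sum>t=s..<s + ks ! m. LINT h|q t. loss h (x ! t))
        \<le> loc_rel F X loss P Rel (ks ! m) (take s x) + L (s + ks ! m) - L s"
      using Suc.prems q[of m] pos nth_mem[of m ks] unfolding L_def s_def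
      by (intro localized_block_loss[OF adm M _ x(1) _ mins]) (auto simp: Suc_le_eq)
    moreover have "(\<Sum>t<s + ks ! m. LINT h|q t. loss h (x ! t))
        = (\<Sum>t<s. LINT h|q t. loss h (x ! t)) + (\<Sum>t=s..<s + ks ! m. LINT h|q t. loss h (x ! t))"
      by (simp add: lessThan_atLeast0 sum.atLeastLessThan_concat)
    ultimately show ?case
      using Suc by (simp add: take blocks_value_append s_def)
  qed (simp add: L0)
  from this[of "length ks"] show ?thesis
    by (simp add: L_def flip: x(2))
qed

section \<open>The block lengths\<close>

lemma replan_positive_sum:
  assumes "blocking_strategy X Block" "set xs \<subseteq> X" "n > 0"
    and "sum_list K = n" "\<forall>k\<in>set K. k > 0"
  shows "sum_list (replan X V Block xs n K) = n \<and> (\<forall>k\<in>set (replan X V Block xs n K). k > 0)"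
  using assms by (auto simp: blocking_strategy_def replan_def)

lemma superblock_lengths_0 [simp]: "superblock_lengths X V Block x s 0 K = []"
  by (subst superblock_lengths.simps) simp

text \<open>One pass of the loop: positive entries keep the termination test \<open>k = 0\<close>
  from firing, and the remaining plan \<open>K'\<close> again satisfies the assumptions for the
  remaining rounds.\<close>

lemma superblock_lengths_unfold:
  assumes "blocking_strategy X Block" "set x \<subseteq> X" "n > 0" "sum_list K = n" "\<forall>k\<in>set K. k > 0"
  obtains k K' where "replan X V Block (take s x) n K = k # K'" "k > 0" "k + sum_list K' = n"
    "\<forall>k\<in>set K'. k > 0"
    "superblock_lengths X V Block x s n K
      = k # superblock_lengths X V Block x (s + k) (n - k) K'"
proof -
  have "set (take s x) \<subseteq> X"
    using assms(2) set_take_subset[of s x] by blast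
  note R = replan_positive_sum[OF assms(1) this assms(3-5), of V]
  obtain k K' where K': "replan X V Block (take s x) n K = k # K'"
    using R assms(3) by (cases "replan X V Block (take s x) n K") auto
  show ?thesis
    using R K' assms(3)
    by (intro that[OF K'], simp_all) (subst superblock_lengths.simps, simp add: Let_def)
qed

lemma superblock_lengths_sum:
  assumes "blocking_strategy X Block" "set x \<subseteq> X" "sum_list K = n" "\<forall>k\<in>set K. k > 0"
  shows "sum_list (superblock_lengths X V Block x s n K) = n \<and>
    (\<forall>k\<in>set (superblock_lengths X V Block x s n K). k > 0)"
  using assms(3,4)
proof (induction n arbitrary: s K rule: less_induct)
  case (less n)
  show ?case
  proof (cases "n = 0")
    case False
    with less.prems obtain k K' where "k > 0" "k + sum_list K' = n" "\<forall>k\<in>set K'. k > 0"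
      "superblock_lengths X V Block x s n K
        = k # superblock_lengths X V Block x (s + k) (n - k) K'"
      by (metis superblock_lengths_unfold[OF assms(1,2)] neq0_conv)
    with less.IH[of "n - k" K' "s + k"] show ?thesis
      by auto
  qed simp
qed

section \<open>Guaranteed values of plans\<close>

lemma guarantee_replan_le:
  "guarantee X V (replan X V Block xs n K) xs \<le> guarantee X V K xs"
  by (auto simp: replan_def)

text \<open>Every continuation \<open>zs\<close> after the actual moves \<open>ys\<close> gives the
  candidate \<open>ys @ zs\<close> in the supremum for the longer plan, so playing a block cannot
  raise the guaranteed value.\<close>

lemma guarantee_Cons_ge:
  assumes "set ys \<subseteq> X" "length ys = k"
  shows "ereal (V k xs) + guarantee X V K (xs @ ys) \<le> guarantee X V (k # K) xs"
proof -
  \<comment> \<open>The finite summand is moved to the right so that the supremum stands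
    alone.\<close>
  have "guarantee X V K (xs @ ys) \<le> guarantee X V (k # K) xs - ereal (V k xs)"
    unfolding guarantee_def[of X V K]
  proof (rule SUP_least)
    fix zs assume zs: "zs \<in> {zs. set zs \<subseteq> X \<and> length zs = sum_list K}"
    let ?S = "\<Sum>j<length K. V (K ! j) ((xs @ ys) @ take (sum_list (take j K)) zs)"
    have "ereal (\<Sum>j<length (k # K). V ((k # K) ! j)
        (xs @ take (sum_list (take j (k # K))) (ys @ zs))) \<le> guarantee X V (k # K) xs"
      unfolding guarantee_def using assms zs by (intro SUP_upper) auto
    then have "ereal (V k xs + ?S) \<le> guarantee X V (k # K) xs"
      using assms(2) by (simp add: sum.lessThan_Suc_shift del: sum.lessThan_Suc)
    then show "ereal ?S \<le> guarantee X V (k # K) xs - ereal (V k xs)"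
      by (simp add: ereal_le_minus add.commute)
  qed
  then show ?thesis by (simp add: ereal_le_minus add.commute)
qed

lemma guarantee_Nil [simp]: "guarantee X V [] xs = 0"
proof -
  \<comment> \<open>The supremum ranges over one empty continuation, not over the empty set, so it
    is 0 and not minus infinity.\<close>
  have "{zs. set zs \<subseteq> X \<and> length zs = 0} = {[]}" by auto
  then show ?thesis by (simp add: guarantee_def)
qed

text \<open>Only the empty prefix of the future enters, so the supremum is of a constant. Equality
  fails if \<open>X\<close> is empty and \<open>k > 0\<close>: the supremum is then minus
  infinity.\<close>

lemma guarantee_singleton_le: "guarantee X V [k] xs \<le> ereal (V k xs)"
  unfolding guarantee_def by (intro SUP_least) simp

text \<open>The guarantee is a potential for the loop: replanning never raises it, and each block
  played accounts for its own value. Induction is on the rounds left, for an arbitrary current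
  plan.\<close>

lemma blocks_value_superblock_le:
  assumes "blocking_strategy X Block" "set x \<subseteq> X"
    and "sum_list K = n" "\<forall>k\<in>set K. k > 0" "s + n \<le> length x"
  shows "ereal (blocks_value V x s (superblock_lengths X V Block x s n K))
    \<le> guarantee X V K (take s x)"
  using assms(3-5)
proof (induction n arbitrary: s K rule: less_induct)
  case (less n)
  show ?case
  proof (cases "n = 0")
    case True
    with less.prems have "K = []" by (cases K) auto
    with True show ?thesis by (simp add: zero_ereal_def)
  next
    case False
    then obtain k K' where k: "replan X V Block (take s x) n K = k # K'" "k > 0"
      "k + sum_list K' = n" "\<forall>k\<in>set K'. k > 0"
      "superblock_lengths X V Block x s n K
        = k # superblock_lengths X V Block x (s + k) (n - k) K'"
      by (metis superblock_lengths_unfold[OF assms(1,2) _ less.prems(1,2)] neq0_conv)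
    have ys: "set (take k (drop s x)) \<subseteq> X" "length (take k (drop s x)) = k"
      using assms(2) less.prems(3) k(3) set_take_subset[of k "drop s x"] set_drop_subset[of s x]
      by auto
    have "ereal (blocks_value V x s (superblock_lengths X V Block x s n K))
        \<le> ereal (V k (take s x)) + guarantee X V K' (take (s + k) x)"
      using less.IH[of "n - k" K' "s + k"] k less.prems(3)
      by (auto simp flip: plus_ereal.simps(1) intro!: add_left_mono)
    also have "\<dots> \<le> guarantee X V (k # K') (take s x)"
      using guarantee_Cons_ge[OF ys, of V "take s x" K'] by (simp add: take_add)
    also have "\<dots> \<le> guarantee X V K (take s x)"
      using guarantee_replan_le[of X V Block "take s x" n K] k(1) by simp
    finally show ?thesis .
  qed
qed

section \<open>Concatenating the super-blocks\<close>

lemma block_lengths_Suc: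
  "block_lengths X V Block (Suc c) x
    = block_lengths X V Block c x @ superblock_lengths X V Block x (2 ^ c - 1) (2 ^ c) [2 ^ c]"
  by (simp add: block_lengths_def)

lemma block_lengths_sum:
  assumes "blocking_strategy X Block" "set x \<subseteq> X"
  shows "sum_list (block_lengths X V Block c x) = 2 ^ c - 1 \<and>
    (\<forall>k\<in>set (block_lengths X V Block c x). k > 0)"
proof (induction c)
  case (Suc c)
  with superblock_lengths_sum[OF assms, of "[2 ^ c]" "2 ^ c" V "2 ^ c - 1"] show ?case
    by (auto simp: block_lengths_Suc)
qed (simp add: block_lengths_def)

text \<open>Super-block \<open>i\<close> starts after \<open>2 ^ i - 1\<close> rounds with the plan
  \<open>[2 ^ i]\<close>, whose guarantee bounds all blocks played in it, whatever
  \<open>Block\<close> proposes.\<close>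

lemma blocks_value_block_lengths_le:
  assumes "blocking_strategy X Block" "set x \<subseteq> X" "2 ^ c - 1 \<le> length x"
  shows "blocks_value V x 0 (block_lengths X V Block c x)
    \<le> (\<Sum>i<c. V (2 ^ i) (take (2 ^ i - 1) x))"
  using assms(3)
proof (induction c)
  case (Suc c)
  have "ereal (blocks_value V x (2 ^ c - 1)
      (superblock_lengths X V Block x (2 ^ c - 1) (2 ^ c) [2 ^ c]))
      \<le> guarantee X V [2 ^ c] (take (2 ^ c - 1) x)"
    using Suc.prems by (intro blocks_value_superblock_le[OF assms(1,2)]) auto
  also have "\<dots> \<le> ereal (V (2 ^ c) (take (2 ^ c - 1) x))"
    by (rule guarantee_singleton_le)
  finally show ?case
    using Suc.IH Suc.prems block_lengths_sum[OF assms(1,2), of V c]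
    by (fastforce simp: block_lengths_Suc blocks_value_append)
qed (simp add: block_lengths_def)

section \<open>Expected regret\<close>

text \<open>Linearity of expectation: the loss of round \<open>t\<close> depends on coordinate
  \<open>t\<close> alone, whose marginal is \<open>q (take t x)\<close>, and the comparator term is
  constant because \<open>x\<close> is fixed.\<close>

lemma expected_regret_eq:
  assumes q: "\<And>t. t < length x \<Longrightarrow> \<exists>G. q (take t x) \<in> dists M X loss G"
    and x: "set x \<subseteq> X" "x \<noteq> []"
  shows "expected_regret F loss q x
    = (\<Sum>t<length x. LINT h|q (take t x). loss h (x ! t)) - (INF g\<in>F. cum_loss loss g x)"
proof -
  \<comment> \<open>The locale of product spaces wants a probability space at every index.\<close>
  define N where "N t = (if t < length x then q (take t x) else q [])" for t
  have prob: "prob_space (N t)" for t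
    using q[of t] q[of 0] x(2) by (auto simp: N_def dists_def)
  interpret product_prob_space N "{..<length x}"
    by (simp add: product_prob_space_def product_prob_space_axioms_def product_sigma_finite_def prob
        prob_space_imp_sigma_finite)
  have int: "integrable (N t) (\<lambda>h. loss h (x ! t))" if "t < length x" for t
    using q[OF that] that subsetD[OF x(1) nth_mem[OF that]] by (auto simp: N_def dists_def)
  have comp: "integrable (PiM {..<length x} N) (\<lambda>f. loss (f t) (x ! t)) \<and>
      (LINT f|PiM {..<length x} N. loss (f t) (x ! t)) = (LINT h|N t. loss h (x ! t))"
    if t: "t < length x" for t
  proof -
    have distr: "distr (PiM {..<length x} N) (N t) (\<lambda>\<omega>. \<omega> t) = N t"
      using t by (intro PiM_component) auto
    have "(\<lambda>h. loss h (x ! t)) \<in> borel_measurable (N t)"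
      using int[OF t] by auto
    moreover have "(\<lambda>\<omega>. \<omega> t) \<in> measurable (PiM {..<length x} N) (N t)"
      using t by (intro measurable_component_singleton) auto
    ultimately show ?thesis
      using int[OF t] integrable_distr_eq[of "\<lambda>\<omega>. \<omega> t" "PiM {..<length x} N" "N t" "\<lambda>h. loss h (x ! t)"]
        integral_distr[of "\<lambda>\<omega>. \<omega> t" "PiM {..<length x} N" "N t" "\<lambda>h. loss h (x ! t)"]
      by (simp add: distr)
  qed
  have "expected_regret F loss q x = (LINT f|PiM {..<length x} N. regret F loss f x)"
    unfolding expected_regret_def
    by (intro arg_cong2[where f = lebesgue_integral] PiM_cong) (auto simp: N_def)
  also have "\<dots> = (\<Sum>t<length x. LINT h|N t. loss h (x ! t)) - (INF g\<in>F. cum_loss loss g x)"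
    unfolding regret_def
    by (subst Bochner_Integration.integral_diff) (auto simp: comp P.prob_space intro!: Bochner_Integration.integrable_sum)
  finally show ?thesis by (simp add: N_def)
qed

text \<open>With \<open>b = 2 powr p\<close> the sum is exactly
  \<open>(b ^ c - 1) / (b - 1)\<close>; the stated form arises by bounding \<open>b ^ c\<close> and
  dividing numerator and denominator by \<open>b\<close>.\<close>

lemma geometric_powr_sum_le:
  fixes p :: real
  assumes "p > 0" "c \<ge> 1"
  shows "(\<Sum>i<c. real (2 ^ i) powr p)
    \<le> (real (2 ^ c - 1) powr p - 2 powr (-p)) / (1 - 2 powr (-p))"
proof -
  define b :: real where "b = 2 powr p"
  have b: "b > 1" using assms(1) by (simp add: b_def)
  have pow: "real (2 ^ i) powr p = b ^ i" for i
    by (simp add: b_def powr_power mult.commute powr_powr flip: powr_realpow)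
  have "b ^ c = real (2 ^ c) powr p" by (simp only: pow)
  \<comment> \<open>This replaces \<open>2 ^ c\<close> by twice the horizon, which is possible since
    \<open>c \<ge> 1\<close>.\<close>
  also have "\<dots> \<le> (2 * real (2 ^ c - 1)) powr p"
  proof (rule powr_mono2)
    have "(2::real) ^ 1 \<le> 2 ^ c" using assms(2) by (intro power_increasing) auto
    then show "real (2 ^ c) \<le> 2 * real (2 ^ c - 1)" by (simp add: of_nat_diff)
  qed (use assms in auto)
  also have "\<dots> = b * real (2 ^ c - 1) powr p" by (subst powr_mult) (simp_all add: b_def)
  finally have "(b ^ c - 1) / (b - 1) \<le> (b * real (2 ^ c - 1) powr p - 1) / (b - 1)"
    using b by (intro divide_right_mono) auto
  also have "\<dots> = (real (2 ^ c - 1) powr p - 1 / b) / (1 - 1 / b)"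
    using b by (simp add: field_simps)
  also have "1 / b = 2 powr (-p)" by (simp add: b_def powr_minus_divide)
  finally show ?thesis
    unfolding pow using b by (simp add: geometric_sum)
qed


theorem lemma7:
  fixes M :: "'f measure" and F :: "'f set" and X :: "'x set"
    and loss :: "'f \<Rightarrow> 'x \<Rightarrow> real"
    and P :: "'f \<Rightarrow> 'x list \<Rightarrow> real"
    and Rel :: "nat \<Rightarrow> 'f set \<Rightarrow> 'x list \<Rightarrow> real"
    and Block :: "'x list \<Rightarrow> nat \<Rightarrow> nat list"
    and q :: "'x list \<Rightarrow> 'f measure"
    and x :: "'x list" and c T :: nat and ks :: "nat list"
  assumes "space M = F"
    and "\<forall>y\<in>X. (\<lambda>f. loss f y) \<in> borel_measurable M"
    and "c \<ge> 2" and "T = 2 ^ c - 1"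
    and "admissible M X loss Rel"
    and "blocking_strategy X Block"
    and "set x \<subseteq> X" and "length x = T"
    and "\<forall>t\<le>T. \<exists>f\<in>F. \<forall>g\<in>F. cum_loss loss f (take t x) \<le> cum_loss loss g (take t x)"
    and "alma_play M X loss P Rel Block c x q"
    and "ks = block_lengths X (loc_rel F X loss P Rel) Block c x"
  shows "expected_regret F loss q x
           \<le> (\<Sum>i<length ks.
                Rel (ks ! i) (loc_class F X loss P (ks ! i) (take (sum_list (take i ks)) x)) []) \<and>
         (\<forall>p::real. 0 < p \<longrightarrow> p \<le> 1 \<longrightarrow>
            (\<forall>t\<ge>1. Rel t F [] \<le> real t powr p) \<longrightarrow>
            (\<forall>t\<ge>1. \<forall>G\<subseteq>F. G \<noteq> {} \<longrightarrow> Rel t G [] \<le> Rel t F []) \<longrightarrow>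
            expected_regret F loss q x
              \<le> (real T powr p - 2 powr (-p)) / (1 - 2 powr (-p)))"
proof -
  note x = assms(7,8)
  define V where "V = loc_rel F X loss P Rel"
  have ks: "sum_list ks = T" "\<forall>k\<in>set ks. k > 0"
    using block_lengths_sum[OF assms(6) x(1), of V c] by (simp_all add: assms(4,11) V_def)
  have play: "met_algo_choice M X loss Rel (ks ! i)
      (loc_class F X loss P (ks ! i) (take (sum_list (take i ks)) x))
      (take j (drop (sum_list (take i ks)) x)) (q (take (sum_list (take i ks) + j) x))"
    if "i < length ks" "j < ks ! i" for i j
    using assms(10) that by (simp add: alma_play_def Let_def assms(1,11))
  have "T > 0"
    using assms(3) one_less_power[of "2::nat" c] by (simp add: assms(4))
  then have "x \<noteq> []" using x(2) by auto
  \<comment> \<open>Every round lies in some block, and the choice made there is a minimizer over a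
    set of distributions.\<close>
  have dist: "\<exists>G. q (take t x) \<in> dists M X loss G" if "t < length x" for t
    using block_index_exists[of t ks] that x(2) ks(1) play
    unfolding met_algo_choice_def is_arg_min_def by metis
  have "expected_regret F loss q x
      = (\<Sum>t<length x. LINT h|q (take t x). loss h (x ! t)) - (INF g\<in>F. cum_loss loss g x)"
    using expected_regret_eq[where q = q and x = x and M = M and X = X and loss = loss,
        OF dist x(1) \<open>x \<noteq> []\<close>] .
  also have "\<dots> \<le> blocks_value V x 0 ks"
    using loss_le_blocks_value[OF assms(5,1) x(1) _ ks(2),
        where q = "\<lambda>t. q (take t x)" and P = P]
      ks(1) x(2) assms(9) play by (simp add: V_def)
  finally have regret: "expected_regret F loss q x \<le> blocks_value V x 0 ks" .
  moreover have "blocks_value V x 0 ks \<le> (real T powr p - 2 powr (-p)) / (1 - 2 powr (-p))"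
    if p: "0 < p" and rate: "\<forall>t\<ge>1. Rel t F [] \<le> real t powr p"
      and mono: "\<forall>t\<ge>1. \<forall>G\<subseteq>F. G \<noteq> {} \<longrightarrow> Rel t G [] \<le> Rel t F []" for p :: real
  proof -
    have "V (2 ^ i) (take (2 ^ i - 1) x) \<le> real (2 ^ i) powr p" if "i < c" for i
    proof -
      define s :: nat where "s = 2 ^ i - 1"
      have "(2::nat) ^ Suc i \<le> 2 ^ c" using that by (intro power_increasing) auto
      then have le: "s + 2 ^ i \<le> T" by (simp add: s_def assms(4))
      \<comment> \<open>A minimizer at the end of the first \<open>2 ^ i\<close> rounds after
        \<open>s\<close> shows that the localized class is nonempty, as \<open>mono\<close>
        requires.\<close>
      obtain f where "f \<in> F"
          "\<forall>g\<in>F. cum_loss loss f (take (s + 2 ^ i) x) \<le> cum_loss loss g (take (s + 2 ^ i) x)"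
        using assms(9) le by blast
      then have "f \<in> loc_class F X loss P (2 ^ i) (take s x)"
        using le x set_take_subset[of "2 ^ i" "drop s x"] set_drop_subset[of s x]
        by (intro minimizer_in_loc_class[where zs = "take (2 ^ i) (drop s x)"]) (auto simp: take_add)
      then have "V (2 ^ i) (take s x) \<le> Rel (2 ^ i) F []"
        using mono loc_class_subset[of F X loss P "2 ^ i" "take s x"]
          one_le_power[of "2::nat" i]
        unfolding V_def loc_rel_def by (metis empty_iff one_le_numeral)
      also have "\<dots> \<le> real (2 ^ i) powr p" using rate one_le_power[of "2::nat" i] by (metis one_le_numeral)
      finally show ?thesis by (simp add: s_def)
    qed
    then have "(\<Sum>i<c. V (2 ^ i) (take (2 ^ i - 1) x)) \<le> (\<Sum>i<c. real (2 ^ i) powr p)"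
      by (intro sum_mono) auto
    moreover have "blocks_value V x 0 ks \<le> (\<Sum>i<c. V (2 ^ i) (take (2 ^ i - 1) x))"
      unfolding assms(11) V_def
      by (rule blocks_value_block_lengths_le[OF assms(6) x(1)]) (simp add: x(2) assms(4))
    ultimately show ?thesis
      using geometric_powr_sum_le[OF p, of c] assms(3,4) by simp
  qed
  ultimately show ?thesis
    by (fastforce simp: blocks_value_def V_def loc_rel_def intro: order_trans)
qed

end
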